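(* Fix $\epsilon_0\in(0,1/2)$. If a probability density $f$ on $\mathbb{R}$ has the form $$f(x)=f(x;u_0,\sigma_0,\epsilon,H)=(1-\epsilon)\frac{1}{\sigma_0}\phi\Big(\frac{x-u_0}{\sigma_0}\Big)+\epsilon\int\frac{1}{\sigma}\phi\Big(\frac{x-u}{\sigma}\Big)\,dH(u,\sigma)$$ with $u_0\in\mathbb{R}$, $\sigma_0>0$, and with $\epsilon$ and $H$ satisfying $$0<\epsilon\le\epsilon_0,\qquad P_H(\sigma\ge\sigma_0)=1,\qquad P_H\big((u,\sigma)\ne(u_0,\sigma_0)\big)=1,$$ then the parameters $u_0$, $\sigma_0$ and $\epsilon$ are uniquely determined by $f$. That is, if $f$ admits two such representations, with parameters $(u_0^{(k)},\sigma_0^{(k)},\epsilon^{(k)},H^{(k)})$, $k=1,2$, each satisfying $u_0^{(k)}\in\mathbb{R}$, $\sigma_0^{(k)}>0$, $0<\epsilon^{(k)}\le\epsilon_0$, $P_{H^{(k)}}(\sigma\ge\sigma_0^{(k)})=1$ and $P_{H^{(k)}}\big((u,\sigma)\ne(u_0^{(k)},\sigma_0^{(k)})\big)=1$ (with the same $\epsilon_0$ for $k=1,2$), then $(u_0^{(1)},\sigma_0^{(1)},\epsilon^{(1)})=(u_0^{(2)},\sigma_0^{(2)},\epsilon^{(2)})$.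
   Context: $\phi$ denotes the density of the standard normal distribution $N(0,1)$. $H$ is a bivariate probability distribution (the mixing distribution) of $(u,\sigma)\in\mathbb{R}\times(0,\infty)$, and $P_H$ denotes probability when $(u,\sigma)\sim H$. *)

theory Defs
  imports "HOL-Probability.Probability"
begin

definition probability_density :: "(real \<Rightarrow> real) \<Rightarrow> bool" where
  "probability_density f \<longleftrightarrow>
     f \<in> borel_measurable borel \<and> (\<forall>x. 0 \<le> f x) \<and>
     prob_space (density lborel (\<lambda>x. ennreal (f x)))"

(* Probability distributions of (u, \<sigma>) whose sample space is exactly the open
   half-plane \<real> \<times> (0,\<infinity>), with its Borel subsets as events. *)
definition mixing_distribution :: "(real \<times> real) measure \<Rightarrow> bool" where
  "mixing_distribution H \<longleftrightarrow>
     prob_space H \<and> sets H = sets (restrict_space borel (UNIV \<times> {0<..}))"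

definition mixture_density ::
    "real \<Rightarrow> real \<Rightarrow> real \<Rightarrow> (real \<times> real) measure \<Rightarrow> real \<Rightarrow> real" where
  "mixture_density u0 \<sigma>0 \<epsilon> H x =
     (1 - \<epsilon>) * (1 / \<sigma>0 * std_normal_density ((x - u0) / \<sigma>0)) +
     \<epsilon> * (\<integral>(u, \<sigma>). 1 / \<sigma> * std_normal_density ((x - u) / \<sigma>) \<partial>H)"

definition admissible ::
    "real \<Rightarrow> real \<Rightarrow> real \<Rightarrow> real \<Rightarrow> (real \<times> real) measure \<Rightarrow> bool" where
  "admissible \<epsilon>0 u0 \<sigma>0 \<epsilon> H \<longleftrightarrow>
     mixing_distribution H \<and> 0 < \<sigma>0 \<and> 0 < \<epsilon> \<and> \<epsilon> \<le> \<epsilon>0 \<and>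
     \<P>((u, \<sigma>) in H. \<sigma>0 \<le> \<sigma>) = 1 \<and>
     \<P>((u, \<sigma>) in H. (u, \<sigma>) \<noteq> (u0, \<sigma>0)) = 1"

end

theory Submission
  imports Defs
begin

text \<open>
  The Fourier transform of a mixture density is a mixture of the Gaussian characteristic
  functions \<open>exp (\<i> u t - \<sigma>\<^sup>2 t\<^sup>2 / 2)\<close>. Multiplying it by \<open>exp (- \<i> a t + s\<^sup>2 t\<^sup>2 / 2)\<close>
  recentres every component at \<open>a\<close> and removes the variance \<open>s\<^sup>2\<close> from it. As long as no component
  has standard deviation below \<open>s\<close>, what remains is again a mixture of Gaussian characteristic
  functions (degenerate ones included): it is the characteristic function of a random variable
  whose atom at 0 is the total weight that the mixture gives to the component \<open>(a, s)\<close>. By Wiener's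
  idea, an atom is found by averaging the characteristic function over ever longer ranges of \<open>t\<close>;
  here \<open>t\<close> runs over \<open>n\<close> times a standard normal variable and \<open>n \<rightarrow> \<infinity>\<close>, so that the average of
  \<open>exp (\<i> x t)\<close> is the rapidly decaying \<open>exp (- n\<^sup>2 x\<^sup>2 / 2)\<close>
  (\<open>gauss_cf_mixture_average_limit\<close>).

  Hence the density \<open>f\<close> alone determines the weight of \<open>(a, s)\<close> for every \<open>s\<close> that does not exceed
  the minimal standard deviation (\<open>mixture_density_atom_limit\<close>). Of two representations with
  \<open>\<sigma>1 \<le> \<sigma>2\<close>, take \<open>(a, s) = (u1, \<sigma>1)\<close>, which is allowed for both. The first one gives the weight
  \<open>1 - \<epsilon>1 > 1 / 2\<close>, because \<open>H1\<close> does not charge \<open>(u1, \<sigma>1)\<close>. In the second one a point other than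
  \<open>(u2, \<sigma>2)\<close> has weight at most \<open>\<epsilon>2 < 1 / 2\<close>. So \<open>(u1, \<sigma>1) = (u2, \<sigma>2)\<close>, and the weights
  \<open>1 - \<epsilon>1\<close> and \<open>1 - \<epsilon>2\<close> of this point agree.
\<close>

section \<open>Gaussian characteristic functions\<close>

text \<open>
  The characteristic function of the normal law with mean \<open>m\<close> and variance \<open>v\<close>. The parameter is
  the variance, and it may be negative: multiplication by the factor with parameters \<open>- a\<close> and
  \<open>- s\<^sup>2\<close> is deconvolution.
\<close>

definition gauss_cf :: "real \<Rightarrow> real \<Rightarrow> real \<Rightarrow> complex" where
  "gauss_cf m v t = iexp (m * t) * complex_of_real (exp (- (v * t\<^sup>2 / 2)))"

lemma gauss_cf_measurable [measurable (raw)]: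
  assumes [measurable]: "f \<in> borel_measurable M" "g \<in> borel_measurable M" "h \<in> borel_measurable M"
  shows "(\<lambda>x. gauss_cf (f x) (g x) (h x)) \<in> borel_measurable M"
  unfolding gauss_cf_def by measurable

lemma norm_gauss_cf: "norm (gauss_cf m v t) = exp (- (v * t\<^sup>2 / 2))"
  by (simp add: gauss_cf_def norm_mult)

lemma norm_gauss_cf_le_1: "0 \<le> v \<Longrightarrow> norm (gauss_cf m v t) \<le> 1"
  by (simp add: norm_gauss_cf)

lemma gauss_cf_mult: "gauss_cf m v t * gauss_cf m' v' t = gauss_cf (m + m') (v + v') t"
proof -
  have "iexp (m * t) * iexp (m' * t) = iexp ((m + m') * t)"
    by (simp add: exp_add [symmetric] algebra_simps)
  moreover have "exp (- (v * t\<^sup>2 / 2)) * exp (- (v' * t\<^sup>2 / 2)) = exp (- ((v + v') * t\<^sup>2 / 2))"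
    by (simp add: exp_add [symmetric] algebra_simps add_divide_distrib)
  ultimately show ?thesis
    unfolding gauss_cf_def by (metis (no_types, lifting) mult.assoc mult.left_commute of_real_mult)
qed

lemma integral_normal_density_iexp:
  assumes "0 < \<sigma>"
  shows "(\<integral>x. (1 / \<sigma> * std_normal_density ((x - u) / \<sigma>)) *\<^sub>R iexp (t * x) \<partial>lborel)
           = gauss_cf u (\<sigma>\<^sup>2) t"
proof -
  have "(\<integral>x. (1 / \<sigma> * std_normal_density ((x - u) / \<sigma>)) *\<^sub>R iexp (t * x) \<partial>lborel)
      = \<bar>\<sigma>\<bar> *\<^sub>R (\<integral>x. (1 / \<sigma> * std_normal_density ((u + \<sigma> * x - u) / \<sigma>)) *\<^sub>R iexp (t * (u + \<sigma> * x)) \<partial>lborel)"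
    using assms by (intro lborel_integral_real_affine) auto
  also have "\<dots> = (\<integral>x. iexp (u * t) * (std_normal_density x *\<^sub>R iexp (\<sigma> * t * x)) \<partial>lborel)"
  proof -
    have "(1 / \<sigma> * std_normal_density ((u + \<sigma> * x - u) / \<sigma>)) *\<^sub>R iexp (t * (u + \<sigma> * x))
        = (1 / \<sigma>) *\<^sub>R (iexp (u * t) * (std_normal_density x *\<^sub>R iexp (\<sigma> * t * x)))" for x
    proof -
      have "iexp (t * (u + \<sigma> * x)) = iexp (u * t) * iexp (\<sigma> * t * x)"
        by (simp add: exp_add [symmetric] algebra_simps)
      then show ?thesis using assms by (simp add: mult_ac)
    qed
    then show ?thesis using assms by (simp only: integral_scaleR_right) simp
  qed
  also have "\<dots> = iexp (u * t) * (\<integral>x. std_normal_density x *\<^sub>R iexp (\<sigma> * t * x) \<partial>lborel)"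
    by (rule integral_mult_right_zero)
  also have "(\<integral>x. std_normal_density x *\<^sub>R iexp (\<sigma> * t * x) \<partial>lborel) = char std_normal_distribution (\<sigma> * t)"
    unfolding char_def by (subst integral_density) auto
  also have "\<dots> = complex_of_real (exp (- (\<sigma>\<^sup>2 * t\<^sup>2 / 2)))"
    by (simp add: char_std_normal_distribution power_mult_distrib)
  finally show ?thesis by (simp add: gauss_cf_def)
qed

section \<open>The Fourier transform of a normal mixture\<close>

lemma scaled_std_normal_density_probability:
  assumes "0 < \<sigma>"
  shows "integrable lborel (\<lambda>x. 1 / \<sigma> * std_normal_density ((x - u) / \<sigma>))"
    and "(\<integral>x. 1 / \<sigma> * std_normal_density ((x - u) / \<sigma>) \<partial>lborel) = 1"
proof -
  have "1 / \<sigma> * std_normal_density ((x - u) / \<sigma>) = normal_density u \<sigma> x" for x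
    using assms by (simp add: normal_density_def power_divide real_sqrt_mult field_simps)
  then show "integrable lborel (\<lambda>x. 1 / \<sigma> * std_normal_density ((x - u) / \<sigma>))"
    and "(\<integral>x. 1 / \<sigma> * std_normal_density ((x - u) / \<sigma>) \<partial>lborel) = 1"
    using assms by simp_all
qed

text \<open>
  Fubini applies because each component density has total integral 1. The mixture integral
  can diverge at single points \<open>x\<close>, since \<open>S\<close> may come arbitrarily close to 0.
\<close>

lemma fourier_normal_mixture:
  assumes "prob_space H"
    and [measurable]: "U \<in> borel_measurable H" "S \<in> borel_measurable H"
    and pos: "\<And>\<omega>. \<omega> \<in> space H \<Longrightarrow> 0 < S \<omega>"
  shows "integrable lborel (\<lambda>x. (\<integral>\<omega>. 1 / S \<omega> * std_normal_density ((x - U \<omega>) / S \<omega>) \<partial>H) *\<^sub>R iexp (t * x))"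
    and "(\<integral>x. (\<integral>\<omega>. 1 / S \<omega> * std_normal_density ((x - U \<omega>) / S \<omega>) \<partial>H) *\<^sub>R iexp (t * x) \<partial>lborel)
           = (\<integral>\<omega>. gauss_cf (U \<omega>) ((S \<omega>)\<^sup>2) t \<partial>H)"
proof -
  interpret H: prob_space H by fact
  interpret P: pair_sigma_finite H lborel ..
  define g where "g \<omega> x = (1 / S \<omega> * std_normal_density ((x - U \<omega>) / S \<omega>)) *\<^sub>R iexp (t * x)" for \<omega> x
  have norm_g: "norm (g \<omega> x) = 1 / S \<omega> * std_normal_density ((x - U \<omega>) / S \<omega>)"
    if "\<omega> \<in> space H" for \<omega> x
    using pos [OF that] by (simp add: g_def)
  have [measurable]: "case_prod g \<in> borel_measurable (H \<Otimes>\<^sub>M lborel)"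
    unfolding g_def normal_density_def by measurable
  have int: "integrable (H \<Otimes>\<^sub>M lborel) (case_prod g)"
  proof (rule P.Fubini_integrable)
    have "integrable H (\<lambda>\<omega>. \<integral>x. norm (g \<omega> x) \<partial>lborel) \<longleftrightarrow> integrable H (\<lambda>\<omega>. 1 :: real)"
      by (intro Bochner_Integration.integrable_cong)
        (simp_all add: norm_g scaled_std_normal_density_probability [OF pos, simplified])
    then show "integrable H (\<lambda>\<omega>. \<integral>x. norm (case (\<omega>, x) of (\<omega>, x) \<Rightarrow> g \<omega> x) \<partial>lborel)"
      by simp
    show "AE \<omega> in H. integrable lborel (\<lambda>x. case (\<omega>, x) of (\<omega>, x) \<Rightarrow> g \<omega> x)"
    proof (intro AE_I2)
      fix \<omega> assume \<omega>: "\<omega> \<in> space H"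
      have "integrable lborel (\<lambda>x. norm (g \<omega> x))"
        using scaled_std_normal_density_probability(1) [OF pos [OF \<omega>]] by (simp add: norm_g [OF \<omega>])
      moreover have "g \<omega> \<in> borel_measurable lborel"
        using \<omega> by measurable
      ultimately show "integrable lborel (\<lambda>x. case (\<omega>, x) of (\<omega>, x) \<Rightarrow> g \<omega> x)"
        by (simp add: integrable_norm_iff)
    qed
  qed measurable
  \<comment> \<open>This holds also at points \<open>x\<close> where the mixture integral diverges: both sides are then 0.\<close>
  have inner: "(\<integral>\<omega>. g \<omega> x \<partial>H)
      = (\<integral>\<omega>. 1 / S \<omega> * std_normal_density ((x - U \<omega>) / S \<omega>) \<partial>H) *\<^sub>R iexp (t * x)" for x
    unfolding g_def scaleR_conv_of_real
    by (simp only: integral_mult_left_zero integral_complex_of_real)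
  have "integrable lborel (\<lambda>x. \<integral>\<omega>. g \<omega> x \<partial>H)"
    by (rule P.integrable_snd [OF int])
  then show "integrable lborel (\<lambda>x. (\<integral>\<omega>. 1 / S \<omega> * std_normal_density ((x - U \<omega>) / S \<omega>) \<partial>H) *\<^sub>R iexp (t * x))"
    by (simp only: inner)
  have "(\<integral>x. (\<integral>\<omega>. g \<omega> x \<partial>H) \<partial>lborel) = (\<integral>\<omega>. (\<integral>x. g \<omega> x \<partial>lborel) \<partial>H)"
    by (rule P.Fubini_integral [OF int])
  also have "\<dots> = (\<integral>\<omega>. gauss_cf (U \<omega>) ((S \<omega>)\<^sup>2) t \<partial>H)"
    unfolding g_def by (intro Bochner_Integration.integral_cong integral_normal_density_iexp pos) auto
  finally show "(\<integral>x. (\<integral>\<omega>. 1 / S \<omega> * std_normal_density ((x - U \<omega>) / S \<omega>) \<partial>H) *\<^sub>R iexp (t * x) \<partial>lborel)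
           = (\<integral>\<omega>. gauss_cf (U \<omega>) ((S \<omega>)\<^sup>2) t \<partial>H)"
    by (simp only: inner)
qed

section \<open>Recovering an atom by averaging\<close>

text \<open>
  For \<open>v = 0\<close> the average is the standard normal characteristic function at \<open>n m\<close>, which decays
  unless \<open>m = 0\<close>. For \<open>v > 0\<close> the integrand itself decays at every \<open>t \<noteq> 0\<close>.
\<close>

lemma gauss_cf_average_limit:
  assumes "0 \<le> v"
  shows "(\<lambda>n. \<integral>t. gauss_cf m v (real n * t) \<partial>std_normal_distribution)
           \<longlonglongrightarrow> of_bool (m = 0 \<and> v = 0)"
proof (cases "v = 0")
  case True
  have "(\<integral>t. gauss_cf m v (real n * t) \<partial>std_normal_distribution)
      = char std_normal_distribution (m * real n)" for n
    by (simp add: gauss_cf_def char_def True mult.assoc)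
  also have "char std_normal_distribution (m * real n) = complex_of_real (exp (- (m * real n)\<^sup>2 / 2))" for n
    by (simp add: char_std_normal_distribution)
  finally have eq: "(\<lambda>n. \<integral>t. gauss_cf m v (real n * t) \<partial>std_normal_distribution)
      = (\<lambda>n. complex_of_real (exp (- (m * real n)\<^sup>2 / 2)))" by simp
  show ?thesis
  proof (cases "m = 0")
    case False
    then have "(\<lambda>n. exp (- (m * real n)\<^sup>2 / 2)) \<longlonglongrightarrow> 0"
      by real_asymp
    then have "(\<lambda>n. complex_of_real (exp (- (m * real n)\<^sup>2 / 2))) \<longlonglongrightarrow> complex_of_real 0"
      by (rule tendsto_of_real)
    then show ?thesis using False unfolding eq by simp
  next
    case m: True
    then show ?thesis using True unfolding eq by simp
  qed
next
  case False
  with assms have v: "0 < v" by simp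
  interpret N: prob_space std_normal_distribution
    by (rule prob_space_normal_density) simp
  have "(\<lambda>n. \<integral>t. gauss_cf m v (real n * t) \<partial>std_normal_distribution)
      \<longlonglongrightarrow> (\<integral>t. 0 \<partial>std_normal_distribution)"
  proof (rule integral_dominated_convergence [where w = "\<lambda>_. 1"])
    have "(\<lambda>n. gauss_cf m v (real n * t)) \<longlonglongrightarrow> 0" if "t \<noteq> 0" for t
    proof (rule tendsto_norm_zero_cancel)
      show "(\<lambda>n. norm (gauss_cf m v (real n * t))) \<longlonglongrightarrow> 0"
        using v that unfolding norm_gauss_cf by real_asymp
    qed
    moreover have "AE t in lborel. t \<noteq> (0 :: real)"
      by (rule AE_lborel_singleton)
    ultimately have "AE t in lborel. 0 < ennreal (std_normal_density t) \<longrightarrow> (\<lambda>n. gauss_cf m v (real n * t)) \<longlonglongrightarrow> 0"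
      by (auto elim: AE_mp)
    then show "AE t in std_normal_distribution. (\<lambda>n. gauss_cf m v (real n * t)) \<longlonglongrightarrow> 0"
      by (subst AE_density) auto
    show "AE t in std_normal_distribution. norm (gauss_cf m v (real n * t)) \<le> 1" for n
      using norm_gauss_cf_le_1 [OF assms] by simp
    show "integrable std_normal_distribution (\<lambda>_. 1 :: real)" by simp
  qed simp_all
  then show ?thesis using False by simp
qed

text \<open>
  The inner integral is the characteristic function of \<open>X + sqrt V * Z\<close> with \<open>Z\<close> standard normal
  and independent of \<open>(X, V)\<close>. The limit is the atom of this variable at 0.
\<close>

lemma gauss_cf_mixture_average_limit:
  assumes "prob_space H"
    and [measurable]: "X \<in> borel_measurable H" "V \<in> borel_measurable H"
    and nonneg: "\<And>\<omega>. 0 \<le> V \<omega>"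
  shows "(\<lambda>n. \<integral>t. (\<integral>\<omega>. gauss_cf (X \<omega>) (V \<omega>) (real n * t) \<partial>H) \<partial>std_normal_distribution)
           \<longlonglongrightarrow> of_real \<P>(\<omega> in H. X \<omega> = 0 \<and> V \<omega> = 0)"
proof -
  interpret H: prob_space H by fact
  interpret N: prob_space std_normal_distribution
    by (rule prob_space_normal_density) simp
  interpret P: pair_prob_space H std_normal_distribution ..
  have swap: "(\<integral>t. (\<integral>\<omega>. gauss_cf (X \<omega>) (V \<omega>) (real n * t) \<partial>H) \<partial>std_normal_distribution)
     = (\<integral>\<omega>. (\<integral>t. gauss_cf (X \<omega>) (V \<omega>) (real n * t) \<partial>std_normal_distribution) \<partial>H)" for n
  proof (rule P.Fubini_integral)
    show "integrable (H \<Otimes>\<^sub>M std_normal_distribution) (\<lambda>(\<omega>, t). gauss_cf (X \<omega>) (V \<omega>) (real n * t))"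
      by (rule P.integrable_const_bound [where B = 1]) (auto intro!: AE_I2 norm_gauss_cf_le_1 nonneg)
  qed
  have "(\<lambda>n. \<integral>\<omega>. (\<integral>t. gauss_cf (X \<omega>) (V \<omega>) (real n * t) \<partial>std_normal_distribution) \<partial>H)
      \<longlonglongrightarrow> (\<integral>\<omega>. of_bool (X \<omega> = 0 \<and> V \<omega> = 0) \<partial>H)"
  proof (rule integral_dominated_convergence [where w = "\<lambda>_. 1"])
    show "AE \<omega> in H. (\<lambda>n. \<integral>t. gauss_cf (X \<omega>) (V \<omega>) (real n * t) \<partial>std_normal_distribution)
        \<longlonglongrightarrow> of_bool (X \<omega> = 0 \<and> V \<omega> = 0)"
      by (intro AE_I2 gauss_cf_average_limit nonneg)
    have "norm (\<integral>t. gauss_cf (X \<omega>) (V \<omega>) (real n * t) \<partial>std_normal_distribution) \<le> 1" for n \<omega>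
    proof -
      have "norm (\<integral>t. gauss_cf (X \<omega>) (V \<omega>) (real n * t) \<partial>std_normal_distribution)
          \<le> (\<integral>t. 1 \<partial>std_normal_distribution)"
        by (rule Bochner_Integration.integral_norm_bound_integral)
          (auto intro!: N.integrable_const_bound [where B = 1] norm_gauss_cf_le_1 nonneg)
      then show ?thesis using N.prob_space by simp
    qed
    then show "AE \<omega> in H. norm (\<integral>t. gauss_cf (X \<omega>) (V \<omega>) (real n * t) \<partial>std_normal_distribution) \<le> 1" for n
      by simp
  qed simp_all
  also have "(\<integral>\<omega>. of_bool (X \<omega> = 0 \<and> V \<omega> = 0) \<partial>H)
      = (\<integral>\<omega>. complex_of_real (indicator {\<omega> \<in> space H. X \<omega> = 0 \<and> V \<omega> = 0} \<omega>) \<partial>H)"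
    by (intro Bochner_Integration.integral_cong) (auto simp: indicator_def)
  also have "\<dots> = of_real \<P>(\<omega> in H. X \<omega> = 0 \<and> V \<omega> = 0)"
    by (subst integral_complex_of_real) simp
  finally show ?thesis unfolding swap .
qed

section \<open>Weights of components of a mixture density\<close>

lemma mixing_distribution_measurable:
  assumes "mixing_distribution H"
  shows "fst \<in> borel_measurable H" and "snd \<in> borel_measurable H" and "space H = UNIV \<times> {0<..}"
proof -
  have H: "sets H = sets (restrict_space borel (UNIV \<times> {0<..}))"
    using assms by (simp add: mixing_distribution_def)
  have "fst \<in> borel_measurable (borel :: (real \<times> real) measure)"
    "snd \<in> borel_measurable (borel :: (real \<times> real) measure)"
    by (intro borel_measurable_continuous_onI continuous_intros)+
  then show "fst \<in> borel_measurable H" "snd \<in> borel_measurable H"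
    by (auto simp: measurable_cong_sets [OF H refl] intro: measurable_restrict_space1)
  show "space H = UNIV \<times> {0<..}"
    using sets_eq_imp_space_eq [OF H] by (simp add: space_restrict_space)
qed

lemma (in prob_space) AE_of_prob_1:
  assumes "\<P>(x in M. P x) = 1"
  shows "AE x in M. P x"
  using AE_prob_1 [OF assms] by simp

text \<open>
  The left-hand side depends on the parameters of the mixture through its density only, and the
  limit is the total weight of the component \<open>(a, s)\<close>. The condition \<open>s \<le> \<sigma>0\<close> leaves a nonnegative
  variance in every component after deconvolution.
\<close>

lemma mixture_density_atom_limit:
  fixes a s :: real
  assumes adm: "admissible \<epsilon>0 u0 \<sigma>0 \<epsilon> H"
    and s: "0 < s" "s \<le> \<sigma>0"
  shows "(\<lambda>n. \<integral>t. gauss_cf (- a) (- s\<^sup>2) (real n * t) *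
             (\<integral>x. mixture_density u0 \<sigma>0 \<epsilon> H x *\<^sub>R iexp (real n * t * x) \<partial>lborel) \<partial>std_normal_distribution)
         \<longlonglongrightarrow> of_real ((1 - \<epsilon>) * of_bool ((u0, \<sigma>0) = (a, s)) + \<epsilon> * \<P>(\<omega> in H. \<omega> = (a, s)))"
proof -
  have mix: "mixing_distribution H" and \<sigma>0: "0 < \<sigma>0"
    using adm by (auto simp: admissible_def)
  interpret H: prob_space H
    using mix by (simp add: mixing_distribution_def)
  interpret N: prob_space std_normal_distribution
    by (rule prob_space_normal_density) simp
  have [measurable]: "fst \<in> borel_measurable H" "snd \<in> borel_measurable H"
    using mixing_distribution_measurable(1,2) [OF mix] .
  have pos: "0 < snd \<omega>" if "\<omega> \<in> space H" for \<omega>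
    using that by (simp add: mixing_distribution_measurable(3) [OF mix] mem_Times_iff)
  have ge: "AE \<omega> in H. \<sigma>0 \<le> snd \<omega>"
    using adm by (intro H.AE_of_prob_1) (simp only: admissible_def split_def prod.collapse)
  \<comment> \<open>Almost surely the absolute value changes nothing. It makes \<open>V\<close> nonnegative everywhere, and
    on the open half-plane it still vanishes only where \<open>snd \<omega> = s\<close>.\<close>
  define V where "V \<omega> = \<bar>(snd \<omega>)\<^sup>2 - s\<^sup>2\<bar>" for \<omega> :: "real \<times> real"
  have [measurable]: "V \<in> borel_measurable H"
    unfolding V_def by measurable
  define \<psi> where "\<psi> t = (\<integral>\<omega>. gauss_cf (fst \<omega> - a) (V \<omega>) t \<partial>H)" for t
  have \<psi>_meas [measurable]: "\<psi> \<in> borel_measurable borel"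
    unfolding \<psi>_def by measurable
  have deconv: "gauss_cf (- a) (- s\<^sup>2) t * (\<integral>x. mixture_density u0 \<sigma>0 \<epsilon> H x *\<^sub>R iexp (t * x) \<partial>lborel)
      = of_real (1 - \<epsilon>) * gauss_cf (u0 - a) (\<sigma>0\<^sup>2 - s\<^sup>2) t + of_real \<epsilon> * \<psi> t" for t
  proof -
    define p where "p x = 1 / \<sigma>0 * std_normal_density ((x - u0) / \<sigma>0)" for x
    define q where "q x = (\<integral>\<omega>. 1 / snd \<omega> * std_normal_density ((x - fst \<omega>) / snd \<omega>) \<partial>H)" for x
    have p: "integrable lborel (\<lambda>x. p x *\<^sub>R iexp (t * x))"
    proof -
      have "integrable lborel (\<lambda>x. norm (p x *\<^sub>R iexp (t * x)))"
        using scaled_std_normal_density_probability(1) [OF \<sigma>0, of u0] \<sigma>0 by (simp add: p_def)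
      moreover have "(\<lambda>x. p x *\<^sub>R iexp (t * x)) \<in> borel_measurable lborel"
        unfolding p_def by measurable
      ultimately show ?thesis using integrable_norm_iff by blast
    qed
    note q = fourier_normal_mixture [OF H.prob_space_axioms mixing_distribution_measurable(1,2) [OF mix] pos, of t,
        folded q_def]
    have "mixture_density u0 \<sigma>0 \<epsilon> H x *\<^sub>R iexp (t * x)
        = (1 - \<epsilon>) *\<^sub>R (p x *\<^sub>R iexp (t * x)) + \<epsilon> *\<^sub>R (q x *\<^sub>R iexp (t * x))" for x
      by (simp add: mixture_density_def p_def q_def split_def algebra_simps)
    then have "(\<integral>x. mixture_density u0 \<sigma>0 \<epsilon> H x *\<^sub>R iexp (t * x) \<partial>lborel)
        = (1 - \<epsilon>) *\<^sub>R (\<integral>x. p x *\<^sub>R iexp (t * x) \<partial>lborel) + \<epsilon> *\<^sub>R (\<integral>x. q x *\<^sub>R iexp (t * x) \<partial>lborel)"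
      using p q(1) by (simp del: scaleR_scaleR)
    also have "\<dots> = of_real (1 - \<epsilon>) * gauss_cf u0 (\<sigma>0\<^sup>2) t
        + of_real \<epsilon> * (\<integral>\<omega>. gauss_cf (fst \<omega>) ((snd \<omega>)\<^sup>2) t \<partial>H)"
      using q(2) integral_normal_density_iexp [OF \<sigma>0, of u0 t] by (simp add: p_def scaleR_conv_of_real)
    finally have F: "(\<integral>x. mixture_density u0 \<sigma>0 \<epsilon> H x *\<^sub>R iexp (t * x) \<partial>lborel)
        = of_real (1 - \<epsilon>) * gauss_cf u0 (\<sigma>0\<^sup>2) t
        + of_real \<epsilon> * (\<integral>\<omega>. gauss_cf (fst \<omega>) ((snd \<omega>)\<^sup>2) t \<partial>H)" .
    have "gauss_cf (- a) (- s\<^sup>2) t * (\<integral>\<omega>. gauss_cf (fst \<omega>) ((snd \<omega>)\<^sup>2) t \<partial>H)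
        = (\<integral>\<omega>. gauss_cf (fst \<omega> - a) ((snd \<omega>)\<^sup>2 - s\<^sup>2) t \<partial>H)"
      by (subst integral_mult_right_zero [symmetric]) (simp add: gauss_cf_mult)
    also have "\<dots> = \<psi> t"
      unfolding \<psi>_def
    proof (rule integral_cong_AE)
      show "AE \<omega> in H. gauss_cf (fst \<omega> - a) ((snd \<omega>)\<^sup>2 - s\<^sup>2) t = gauss_cf (fst \<omega> - a) (V \<omega>) t"
        using ge
      proof eventually_elim
        case (elim \<omega>)
        then have "s\<^sup>2 \<le> (snd \<omega>)\<^sup>2" using s by (intro power_mono) auto
        then show ?case by (simp add: V_def)
      qed
    qed measurable
    finally have "gauss_cf (- a) (- s\<^sup>2) t * (\<integral>\<omega>. gauss_cf (fst \<omega>) ((snd \<omega>)\<^sup>2) t \<partial>H) = \<psi> t" .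
    moreover have "gauss_cf (- a) (- s\<^sup>2) t * gauss_cf u0 (\<sigma>0\<^sup>2) t = gauss_cf (u0 - a) (\<sigma>0\<^sup>2 - s\<^sup>2) t"
      by (simp add: gauss_cf_mult)
    ultimately show ?thesis
      unfolding F by (simp add: distrib_left mult.left_commute [of "gauss_cf (- a) (- s\<^sup>2) t"])
  qed
  have v0: "0 \<le> \<sigma>0\<^sup>2 - s\<^sup>2" using s by (simp add: power_mono)
  have int1: "integrable std_normal_distribution (\<lambda>t. gauss_cf (u0 - a) (\<sigma>0\<^sup>2 - s\<^sup>2) (real n * t))" for n
    by (rule N.integrable_const_bound [where B = 1]) (auto intro: norm_gauss_cf_le_1 v0)
  have int2: "integrable std_normal_distribution (\<lambda>t. \<psi> (real n * t))" for n
  proof (rule N.integrable_const_bound [where B = 1])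
    have "norm (\<psi> t) \<le> 1" for t
    proof -
      have "norm (\<psi> t) \<le> (\<integral>\<omega>. 1 \<partial>H)"
        unfolding \<psi>_def by (rule Bochner_Integration.integral_norm_bound_integral)
          (auto intro!: H.integrable_const_bound [where B = 1] norm_gauss_cf_le_1 simp: V_def)
      then show ?thesis using H.prob_space by simp
    qed
    then show "AE t in std_normal_distribution. norm (\<psi> (real n * t)) \<le> 1" by simp
  qed measurable
  have "(\<lambda>n. of_real (1 - \<epsilon>) * (\<integral>t. gauss_cf (u0 - a) (\<sigma>0\<^sup>2 - s\<^sup>2) (real n * t) \<partial>std_normal_distribution)
        + of_real \<epsilon> * (\<integral>t. \<psi> (real n * t) \<partial>std_normal_distribution))
     \<longlonglongrightarrow> of_real (1 - \<epsilon>) * of_bool (u0 - a = 0 \<and> \<sigma>0\<^sup>2 - s\<^sup>2 = 0)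
        + of_real \<epsilon> * of_real (measure H {\<omega> \<in> space H. fst \<omega> - a = 0 \<and> V \<omega> = 0})"
    unfolding \<psi>_def
    by (intro tendsto_intros gauss_cf_average_limit gauss_cf_mixture_average_limit H.prob_space_axioms v0)
      (auto simp: V_def)
  also have "{\<omega> \<in> space H. fst \<omega> - a = 0 \<and> V \<omega> = 0} = {\<omega> \<in> space H. \<omega> = (a, s)}"
    using pos s by (auto simp: V_def power2_eq_iff) (metis less_asym' pos snd_conv neg_less_0_iff_less)
  also have "(u0 - a = 0 \<and> \<sigma>0\<^sup>2 - s\<^sup>2 = 0) \<longleftrightarrow> (u0, \<sigma>0) = (a, s)"
    using s by (auto simp: power2_eq_iff)
  also have "of_bool ((u0, \<sigma>0) = (a, s)) = complex_of_real (of_bool ((u0, \<sigma>0) = (a, s)))"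
    by simp
  finally show ?thesis
    unfolding deconv using int1 int2 by (simp split del: split_of_bool)
qed

theorem lemma1p1:
  fixes \<epsilon>0 :: real and f :: "real \<Rightarrow> real"
    and u1 \<sigma>1 \<epsilon>1 u2 \<sigma>2 \<epsilon>2 :: real
    and H1 H2 :: "(real \<times> real) measure"
  assumes "0 < \<epsilon>0" and "\<epsilon>0 < 1 / 2"
    and "probability_density f"
    and "admissible \<epsilon>0 u1 \<sigma>1 \<epsilon>1 H1"
    and "\<And>x. f x = mixture_density u1 \<sigma>1 \<epsilon>1 H1 x"
    and "admissible \<epsilon>0 u2 \<sigma>2 \<epsilon>2 H2"
    and "\<And>x. f x = mixture_density u2 \<sigma>2 \<epsilon>2 H2 x"
  shows "(u1, \<sigma>1, \<epsilon>1) = (u2, \<sigma>2, \<epsilon>2)"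
proof -
  have main: "(u, \<sigma>, \<epsilon>) = (u', \<sigma>', \<epsilon>')"
    if adm: "admissible \<epsilon>0 u \<sigma> \<epsilon> H" and f: "\<And>x. f x = mixture_density u \<sigma> \<epsilon> H x"
      and adm': "admissible \<epsilon>0 u' \<sigma>' \<epsilon>' H'" and f': "\<And>x. f x = mixture_density u' \<sigma>' \<epsilon>' H' x"
      and le: "\<sigma> \<le> \<sigma>'"
    for u \<sigma> \<epsilon> H u' \<sigma>' \<epsilon>' H'
  proof -
    have pos: "0 < \<sigma>" and e': "0 < \<epsilon>'" "\<epsilon>' < 1 / 2" and e: "\<epsilon> < 1 / 2"
      using adm adm' assms(2) by (auto simp: admissible_def)
    \<comment> \<open>Both representations give the weight of the component \<open>(u, \<sigma>)\<close>.\<close>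
    have "mixture_density u \<sigma> \<epsilon> H = mixture_density u' \<sigma>' \<epsilon>' H'"
      using f f' by auto
    then have "complex_of_real ((1 - \<epsilon>) * of_bool ((u, \<sigma>) = (u, \<sigma>)) + \<epsilon> * \<P>(\<omega> in H. \<omega> = (u, \<sigma>)))
      = of_real ((1 - \<epsilon>') * of_bool ((u', \<sigma>') = (u, \<sigma>)) + \<epsilon>' * \<P>(\<omega> in H'. \<omega> = (u, \<sigma>)))"
      using mixture_density_atom_limit [OF adm pos order_refl, of u]
        mixture_density_atom_limit [OF adm' pos le, of u]
      by (simp only: LIMSEQ_unique)
    then have eq: "1 - \<epsilon> + \<epsilon> * \<P>(\<omega> in H. \<omega> = (u, \<sigma>))
      = (1 - \<epsilon>') * of_bool ((u', \<sigma>') = (u, \<sigma>)) + \<epsilon>' * \<P>(\<omega> in H'. \<omega> = (u, \<sigma>))"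
      by (simp only: of_real_eq_iff) simp
    have atom: "\<P>(\<omega> in H. \<omega> = (u, \<sigma>)) = 0"
      if "admissible \<epsilon>0 u \<sigma> \<epsilon> H" for u \<sigma> \<epsilon> H
    proof -
      interpret H: prob_space H
        using that by (simp add: admissible_def mixing_distribution_def)
      have "AE \<omega> in H. \<not> \<omega> = (u, \<sigma>)"
        using that by (intro H.AE_of_prob_1) (simp only: admissible_def split_def prod.collapse)
      then show ?thesis by (rule H.prob_eq_0_AE)
    qed
    interpret H': prob_space H'
      using adm' by (simp add: admissible_def mixing_distribution_def)
    show ?thesis
    proof (cases "(u', \<sigma>') = (u, \<sigma>)")
      case True
      then have "\<P>(\<omega> in H'. \<omega> = (u, \<sigma>)) = 0"
        using atom [OF adm'] by simp
      then show ?thesis using eq atom [OF adm] True by simp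
    next
      case False
      have "\<epsilon>' * \<P>(\<omega> in H'. \<omega> = (u, \<sigma>)) \<le> \<epsilon>'"
        using e' by (simp add: mult_left_le)
      moreover have "1 - \<epsilon> = \<epsilon>' * \<P>(\<omega> in H'. \<omega> = (u, \<sigma>))"
        using eq False by (simp only: atom [OF adm] of_bool_eq)
      ultimately have False using e e' by linarith
      then show ?thesis ..
    qed
  qed
  show ?thesis
    using main [OF assms(4-7)] main [OF assms(6,7,4,5)] by (cases "\<sigma>1 \<le> \<sigma>2") auto
qed

end
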